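(* For an integer $k$, let $ex_2(SC_k^3,n)$ denote the maximum number of edges of an $n$-vertex geometric $3$-hypergraph in the plane that does not contain $k$ strongly crossing edges. Then for every fixed integer $k\ge 4$, $ex_2(SC_k^3,n)\le O\left(n^{3-\frac1k}\right)$; that is, for every integer $k\ge 4$ there is a constant $C_k$ depending only on $k$ such that $ex_2(SC_k^3,n)\le C_k\,n^{3-\frac1k}$ for all $n\ge 1$.
   Context: A geometric $3$-hypergraph in the plane is a pair $H=(V,E)$, where $V$ is a finite set of points in general position in $\mathbb{R}^2$ (no three on a line) and $E$ is a set of closed triangles, each being the convex hull of some $3$-element subset of $V$ (its vertices). $H$ is $n$-vertex if $|V|=n$. $H$ contains $k$ strongly crossing edges if there are $k$ edges in $E$ that are pairwise vertex disjoint (no two share a vertex) and such that all $k$ closed triangles have a common point. *)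

theory Defs
  imports "HOL-Analysis.Analysis"
begin

definition general_position :: "(real ^ 2) set \<Rightarrow> bool" where
  "general_position V \<longleftrightarrow> (\<forall>T \<subseteq> V. card T = 3 \<longrightarrow> \<not> collinear T)"

text \<open>Edges are the closed triangles themselves, as subsets of the plane.\<close>

definition geometric_3_hypergraph :: "(real ^ 2) set \<Rightarrow> (real ^ 2) set set \<Rightarrow> bool" where
  "geometric_3_hypergraph V E \<longleftrightarrow>
     finite V \<and> general_position V \<and>
     (\<forall>e \<in> E. \<exists>T \<subseteq> V. card T = 3 \<and> e = convex hull T)"

text \<open>The vertex triple of an edge is unique when \<open>V\<close> is in general position;
  see \<open>edge_vertices_convex_hull\<close> below.\<close>

definition edge_vertices :: "(real ^ 2) set \<Rightarrow> (real ^ 2) set \<Rightarrow> (real ^ 2) set" where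
  "edge_vertices V e = (THE T. T \<subseteq> V \<and> card T = 3 \<and> e = convex hull T)"

definition contains_strongly_crossing ::
    "nat \<Rightarrow> (real ^ 2) set \<Rightarrow> (real ^ 2) set set \<Rightarrow> bool" where
  "contains_strongly_crossing k V E \<longleftrightarrow>
     (\<exists>F \<subseteq> E. finite F \<and> card F = k \<and>
        pairwise (\<lambda>e f. edge_vertices V e \<inter> edge_vertices V f = {}) F \<and>
        \<Inter>F \<noteq> {})"

definition SC_free_sizes :: "nat \<Rightarrow> nat \<Rightarrow> nat set" where
  "SC_free_sizes k n =
     {card E | V E. geometric_3_hypergraph V E \<and> card V = n \<and>
                    \<not> contains_strongly_crossing k V E}"

text \<open>For \<open>k \<ge> 1\<close> the maximum is taken over a finite nonempty set;
  see \<open>finite_SC_free_sizes\<close> and \<open>SC_free_sizes_nonempty\<close> below.\<close>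

definition ex2_SC :: "nat \<Rightarrow> nat \<Rightarrow> nat" where
  "ex2_SC k n = Max (SC_free_sizes k n)"


lemma extreme_points_triangle:
  fixes T :: "(real ^ 2) set"
  assumes "card T = 3" "\<not> collinear T"
  shows "{x. x extreme_point_of (convex hull T)} = T"
proof -
  obtain a b c where "T = {a, b, c}" "a \<noteq> b" "b \<noteq> c" "a \<noteq> c"
    using assms(1) by (metis card_3_iff)
  then have "\<not> affine_dependent T"
    using assms(2) collinear_3_eq_affine_dependent by blast
  then show ?thesis
    by (auto simp: extreme_point_of_convex_hull_affine_independent)
qed

lemma edge_vertices_convex_hull:
  assumes "general_position V" "T \<subseteq> V" "card T = 3"
  shows "edge_vertices V (convex hull T) = T"
  unfolding edge_vertices_def
proof (rule the_equality)
  fix S assume "S \<subseteq> V \<and> card S = 3 \<and> convex hull T = convex hull S"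
  then show "S = T"
    using assms extreme_points_triangle unfolding general_position_def by metis
qed (use assms in auto)

lemma finite_SC_free_sizes: "finite (SC_free_sizes k n)"
proof (rule finite_subset)
  show "SC_free_sizes k n \<subseteq> {..2 ^ n}"
  proof
    fix m assume "m \<in> SC_free_sizes k n"
    then obtain V E where m: "m = card E" and H: "geometric_3_hypergraph V E" and n: "card V = n"
      unfolding SC_free_sizes_def by blast
    from H have V: "finite V" and "E \<subseteq> (\<lambda>T. convex hull T) ` Pow V"
      unfolding geometric_3_hypergraph_def by auto
    then have "card E \<le> card (Pow V)"
      using surj_card_le by blast
    then show "m \<in> {..2 ^ n}"
      using m n V by (simp add: card_Pow)
  qed
qed simp

lemma general_position_parabola:
  "general_position (range (\<lambda>t. vector [t, t\<^sup>2]))"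
  unfolding general_position_def
proof (intro allI impI notI)
  fix T :: "(real ^ 2) set"
  assume T: "T \<subseteq> range (\<lambda>t. vector [t, t\<^sup>2])" "card T = 3" "collinear T"
  then obtain x y z where xyz: "T = {x, y, z}" "x \<noteq> y" "y \<noteq> z" "x \<noteq> z"
    by (metis card_3_iff)
  with T(1) obtain a b c :: real
    where abc: "x = vector [a, a\<^sup>2]" "y = vector [b, b\<^sup>2]" "z = vector [c, c\<^sup>2]"
    by auto
  with xyz have ne: "a \<noteq> b" "b \<noteq> c" "a \<noteq> c"
    by auto
  have "collinear {x, y, z}"
    using T(3) xyz(1) by simp
  then obtain u where "y = u *\<^sub>R x + (1 - u) *\<^sub>R z"
    using xyz(4) unfolding collinear_3_expand by auto
  then have "y $ 1 = u * x $ 1 + (1 - u) * z $ 1" "y $ 2 = u * x $ 2 + (1 - u) * z $ 2"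
    by simp_all
  then have "b = u * a + (1 - u) * c" "b\<^sup>2 = u * a\<^sup>2 + (1 - u) * c\<^sup>2"
    by (simp_all add: abc vector_2)
  then have "(b - a) * (b - c) = 0"
    by algebra
  with ne show False
    by simp
qed

lemma SC_free_sizes_nonempty:
  assumes "k \<ge> 1"
  shows "SC_free_sizes k n \<noteq> {}"
proof -
  define p :: "nat \<Rightarrow> real ^ 2" where "p i = vector [real i, (real i)\<^sup>2]" for i
  have "inj p"
    unfolding inj_def p_def by (metis of_nat_eq_iff vector_2(1))
  then have "card (p ` {..<n}) = n"
    by (simp add: card_image inj_on_subset)
  moreover have "geometric_3_hypergraph (p ` {..<n}) {}"
    using general_position_parabola
    unfolding geometric_3_hypergraph_def general_position_def p_def by blast
  moreover have "\<not> contains_strongly_crossing k (p ` {..<n}) {}"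
    using assms by (auto simp: contains_strongly_crossing_def)
  ultimately show ?thesis
    unfolding SC_free_sizes_def by blast
qed

end

theory Submission
  imports Defs
begin

text \<open>
  Any \<open>u, v, w\<close> with \<open>v\<close> left and \<open>w\<close> right of \<open>u\<close> determine a candidate point, the intersection of
  the segment \<open>vw\<close> with the vertical line through \<open>u\<close>. Among \<open>N\<close> points in general position only
  \<open>O(N\<^sup>2)\<close> triangles contain no candidate determined by three other points. As in the probabilistic
  proof of the crossing lemma, applying this to a random sample of the \<open>n\<close> vertices turns \<open>m\<close> edges
  into at least a constant times \<open>m\<^sup>4 / n\<^sup>6\<close> incidences between edges and candidates. Without \<open>k\<close>
  strongly crossing edges every point lies in \<open>O(k n\<^sup>2)\<close> edges, since a maximal disjoint family
  among them has fewer than \<open>k\<close> members and meets all of them. There are at most \<open>n\<^sup>3\<close> candidates,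
  so \<open>m\<^sup>4 = O(k n\<^sup>1\<^sup>1)\<close>; the exponent \<open>11/4\<close> is at most \<open>3 - 1/k\<close> for \<open>k \<ge> 4\<close>.
\<close>

section \<open>Empty caps among finitely many points, in coordinates\<close>

text \<open>\<open>X\<close> and \<open>Y\<close> are arbitrary functions, so that the counting of
  caps can be used with a sheared abscissa and with either sign of the ordinate.\<close>

definition slope :: "('a \<Rightarrow> real) \<Rightarrow> ('a \<Rightarrow> real) \<Rightarrow> 'a \<Rightarrow> 'a \<Rightarrow> real" where
  "slope X Y p q = (Y q - Y p) / (X q - X p)"

definition height :: "('a \<Rightarrow> real) \<Rightarrow> ('a \<Rightarrow> real) \<Rightarrow> 'a \<Rightarrow> 'a \<Rightarrow> real \<Rightarrow> real" where
  "height X Y p q x = Y p + slope X Y p q * (x - X p)"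

text \<open>For a cap with top \<open>b\<close> this is the closed triangle \<open>abc\<close>,
  sliced by vertical lines: above the chord \<open>ac\<close> and below one of the two upper
  sides.\<close>

definition under_cap ::
    "('a \<Rightarrow> real) \<Rightarrow> ('a \<Rightarrow> real) \<Rightarrow> 'a \<Rightarrow> 'a \<Rightarrow> 'a \<Rightarrow> real \<Rightarrow> real \<Rightarrow> bool" where
  "under_cap X Y a b c x y \<longleftrightarrow> height X Y a c x \<le> y \<and>
     (X a \<le> x \<and> x \<le> X b \<and> y \<le> height X Y a b x \<or>
      X b \<le> x \<and> x \<le> X c \<and> y \<le> height X Y b c x)"

text \<open>Only triangles whose middle vertex lies above the opposite edge are caps; the other ones are
  caps for the reflected coordinate \<open>- Y\<close>.\<close>

definition caps :: "('a \<Rightarrow> real) \<Rightarrow> ('a \<Rightarrow> real) \<Rightarrow> 'a set \<Rightarrow> ('a \<times> 'a \<times> 'a) set" where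
  "caps X Y Z = {(a, b, c). a \<in> Z \<and> b \<in> Z \<and> c \<in> Z \<and> X a < X b \<and> X b < X c \<and>
     height X Y a c (X b) < Y b}"

text \<open>Candidates that use a vertex of the cap are disregarded, so every incidence that
  destroys emptiness spans six distinct points. Sampling relies on this six.\<close>

definition empty_caps :: "('a \<Rightarrow> real) \<Rightarrow> ('a \<Rightarrow> real) \<Rightarrow> 'a set \<Rightarrow> ('a \<times> 'a \<times> 'a) set" where
  "empty_caps X Y Z = {(a, b, c). (a, b, c) \<in> caps X Y Z \<and>
     (\<forall>u \<in> Z - {a, b, c}. \<forall>v \<in> Z - {a, b, c}. \<forall>w \<in> Z - {a, b, c}.
        X v < X u \<longrightarrow> X u < X w \<longrightarrow> \<not> under_cap X Y a b c (X u) (height X Y v w (X u)))}"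

lemma slope_commute: "slope X Y p q = slope X Y q p"
  by (simp add: slope_def) (metis minus_diff_eq minus_divide_divide)

lemma height_left: "height X Y p q (X p) = Y p"
  by (simp add: height_def)

lemma height_alt:
  assumes "X p \<noteq> X q"
  shows "height X Y p q x = Y q - slope X Y p q * (X q - x)"
  using assms by (simp add: height_def slope_def field_simps)

lemma height_mono_right:
  assumes "slope X Y a c < slope X Y a d" "X a < x"
  shows "height X Y a c x < height X Y a d x"
  using assms by (simp add: height_def)

lemma height_mono_left:
  assumes "slope X Y a c < slope X Y b c" "x < X c" "X a \<noteq> X c" "X b \<noteq> X c"
  shows "height X Y b c x < height X Y a c x"
  using assms by (simp add: height_alt)

lemma caps_slopes:
  assumes "(a, b, c) \<in> caps X Y Z"
  shows "slope X Y a c < slope X Y a b" "slope X Y b c < slope X Y a c"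
proof -
  have *: "X a < X b" "X b < X c" "height X Y a c (X b) < Y b"
    using assms by (auto simp: caps_def)
  then show "slope X Y a c < slope X Y a b"
    by (simp add: height_def slope_def field_simps)
  have "Y c - slope X Y a c * (X c - X b) < Y b"
    using * by (simp add: height_alt)
  then show "slope X Y b c < slope X Y a c"
    using * unfolding slope_def[of X Y b c] by (simp add: field_simps)
qed

text \<open>Since \<open>val\<close> separates the elements of a fibre of \<open>key\<close>, each
  fibre has at most one minimiser. Negating \<open>val\<close> gives the same for
  maximisers.\<close>

lemma card_fibre_minimal_le:
  fixes val :: "'a \<Rightarrow> real"
  assumes "finite K" "key ` S \<subseteq> K"
    and "\<And>s t. s \<in> S \<Longrightarrow> t \<in> S \<Longrightarrow> key s = key t \<Longrightarrow> val s = val t \<Longrightarrow> s = t"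
  shows "card {s \<in> S. \<forall>t \<in> S. key t = key s \<longrightarrow> val s \<le> val t} \<le> card K"
proof (rule card_inj_on_le[of key])
  show "inj_on key {s \<in> S. \<forall>t \<in> S. key t = key s \<longrightarrow> val s \<le> val t}"
    by (rule inj_onI) (auto intro!: assms(3) antisym)
qed (use assms(1,2) in auto)

text \<open>The three caps over \<open>(a, c)\<close> with tops \<open>b1\<close>, \<open>b2\<close>, \<open>b3\<close> are played off on the vertical line
  through \<open>b2\<close>: emptiness of \<open>(a2, b1, c)\<close> puts \<open>a c2\<close> above \<open>a1 c\<close> there, while emptiness of
  \<open>(a, b3, c1)\<close> puts \<open>a1 c\<close> above \<open>a c2\<close>.\<close>

lemma no_three_surrounded_caps:
  assumes e: "(a, b1, c) \<in> empty_caps X Y Z" "(a, b2, c) \<in> empty_caps X Y Z"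
      "(a, b3, c) \<in> empty_caps X Y Z"
    and b: "X b1 < X b2" "X b2 < X b3"
    and a: "(a1, b1, c) \<in> empty_caps X Y Z" "slope X Y a1 c < slope X Y a c"
      "(a2, b1, c) \<in> empty_caps X Y Z" "slope X Y a c < slope X Y a2 c"
    and c: "(a, b3, c1) \<in> empty_caps X Y Z" "slope X Y a c1 < slope X Y a c"
      "(a, b3, c2) \<in> empty_caps X Y Z" "slope X Y a c < slope X Y a c2"
  shows False
proof -
  let ?x = "X b2" and ?h = "height X Y"
  have Z: "{a, b1, b2, b3, c, a1, a2, c1, c2} \<subseteq> Z"
    using assms by (auto simp: empty_caps_def caps_def)
  have ord: "X a < X b1" "X b3 < X c" "X a1 < X b1" "X a2 < X b1" "X b3 < X c1" "X b3 < X c2"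
    using assms by (auto simp: empty_caps_def caps_def)
  have caps: "(a1, b1, c) \<in> caps X Y Z" "(a, b3, c2) \<in> caps X Y Z"
    using assms by (auto simp: empty_caps_def)
  \<comment> \<open>Over \<open>b2\<close> the candidate on \<open>a c2\<close> lies above
    \<open>a c\<close>, hence above the chord \<open>a2 c\<close>. It can avoid the triangle only by
    lying above its side \<open>b1 c\<close>.\<close>
  have "\<not> under_cap X Y a2 b1 c ?x (?h a c2 ?x)"
  proof -
    have "b2 \<in> Z - {a2, b1, c}" "a \<in> Z - {a2, b1, c}" "c2 \<in> Z - {a2, b1, c}"
      using Z ord b a c by auto
    then show ?thesis
      using a(3) ord b unfolding empty_caps_def by auto
  qed
  moreover have "?h a2 c ?x < ?h a c ?x" "?h a c ?x < ?h a c2 ?x"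
    using ord b a c by (auto intro!: height_mono_right height_mono_left)
  ultimately have 1: "?h b1 c ?x < ?h a c2 ?x"
    using ord b by (auto simp: under_cap_def)
  have 2: "?h a1 c ?x < ?h b1 c ?x"
    using ord b caps_slopes[OF caps(1)] by (auto intro!: height_mono_left)
  \<comment> \<open>The mirror image: the candidate on \<open>a1 c\<close> lies above the chord
    \<open>a c1\<close>, so it must lie above the side \<open>a b3\<close>.\<close>
  have "\<not> under_cap X Y a b3 c1 ?x (?h a1 c ?x)"
  proof -
    have "b2 \<in> Z - {a, b3, c1}" "a1 \<in> Z - {a, b3, c1}" "c \<in> Z - {a, b3, c1}"
      using Z ord b a c by auto
    then show ?thesis
      using c(1) ord b unfolding empty_caps_def by auto
  qed
  moreover have "?h a c1 ?x < ?h a c ?x" "?h a c ?x < ?h a1 c ?x"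
    using ord b a c by (auto intro!: height_mono_right height_mono_left)
  ultimately have 3: "?h a b3 ?x < ?h a1 c ?x"
    using ord b by (auto simp: under_cap_def)
  have 4: "?h a c2 ?x < ?h a b3 ?x"
    using ord b caps_slopes[OF caps(2)] by (auto intro!: height_mono_right)
  \<comment> \<open>The heights over \<open>b2\<close> form a strict cycle: \<open>a c2\<close> <
    \<open>a b3\<close> < \<open>a1 c\<close> < \<open>b1 c\<close> < \<open>a c2\<close>.\<close>
  from 1 2 3 4 show False by linarith
qed

text \<open>Each empty cap is charged to a pair of its vertices: to \<open>(b, c)\<close> or
  \<open>(a, b)\<close> if the slope of its chord \<open>ac\<close> is extremal among the empty caps
  with that pair, otherwise to \<open>(a, c)\<close> as leftmost or rightmost remaining top. These
  are six charges, and each pair receives each of them at most once.\<close>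

lemma card_empty_caps_le:
  fixes X Y :: "'a \<Rightarrow> real"
  assumes Z: "finite Z" "inj_on X Z"
    and gp: "\<And>p q r. p \<in> Z \<Longrightarrow> q \<in> Z \<Longrightarrow> r \<in> Z \<Longrightarrow> p \<noteq> q \<Longrightarrow> p \<noteq> r \<Longrightarrow> q \<noteq> r \<Longrightarrow>
      slope X Y p r \<noteq> slope X Y q r"
  shows "card (empty_caps X Y Z) \<le> 6 * (card Z)\<^sup>2"
proof -
  define U where "U = empty_caps X Y Z"
  define K where "K = Z \<times> Z"
  define low :: "('a \<times> 'a \<times> 'a) set \<Rightarrow> ('a \<times> 'a \<times> 'a \<Rightarrow> 'a \<times> 'a) \<Rightarrow> ('a \<times> 'a \<times> 'a \<Rightarrow> real) \<Rightarrow> _"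
    where "low = (\<lambda>S key val. {s \<in> S. \<forall>t \<in> S. key t = key s \<longrightarrow> val s \<le> val t})"
  define bc ab ac :: "'a \<times> 'a \<times> 'a \<Rightarrow> 'a \<times> 'a"
    where "bc = (\<lambda>(a, b, c). (b, c))" and "ab = (\<lambda>(a, b, c). (a, b))" and "ac = (\<lambda>(a, b, c). (a, c))"
  define sl where "sl = (\<lambda>(a, b :: 'a, c). slope X Y a c)"
  define xb where "xb = (\<lambda>(a :: 'a, b, c :: 'a). X b)"
  \<comment> \<open>After discarding the extremal slopes in each fibre, every \<open>(a, c)\<close> has at most two tops left.\<close>
  define R where "R = U - (low U bc sl \<union> low U bc (\<lambda>s. - sl s) \<union> low U ab sl \<union> low U ab (\<lambda>s. - sl s))"
  have UZ: "a \<in> Z" "b \<in> Z" "c \<in> Z" "X a < X b" "X b < X c" if "(a, b, c) \<in> U" for a b c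
    using that by (auto simp: U_def empty_caps_def caps_def)
  have finU: "finite U"
    by (rule finite_subset[of _ "Z \<times> Z \<times> Z"]) (use UZ Z in auto)
  have K: "finite K" "card K = (card Z)\<^sup>2"
    using Z by (auto simp: K_def card_cartesian_product power2_eq_square)
  have key: "bc ` U \<subseteq> K" "ab ` U \<subseteq> K" "ac ` U \<subseteq> K"
    using UZ by (auto simp: bc_def ab_def ac_def K_def)
  \<comment> \<open>Equal chord slopes at the common endpoint \<open>c\<close> would put three
    points of \<open>Z\<close> on a line.\<close>
  have inj_bc: "s = t" if st: "s \<in> U" "t \<in> U" "bc s = bc t" "sl s = sl t" for s t
  proof -
    obtain a b c a' where s: "s = (a, b, c)" "t = (a', b, c)"
      using st(3) by (cases s; cases t) (auto simp: bc_def)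
    have "a \<in> Z" "a' \<in> Z" "c \<in> Z" "a \<noteq> c" "a' \<noteq> c" "slope X Y a c = slope X Y a' c"
      using st UZ[of a b c] UZ[of a' b c] by (auto simp: s sl_def)
    then show ?thesis
      using gp[of a a' c] by (auto simp: s)
  qed
  have inj_ab: "s = t" if st: "s \<in> U" "t \<in> U" "ab s = ab t" "sl s = sl t" for s t
  proof -
    obtain a b c c' where s: "s = (a, b, c)" "t = (a, b, c')"
      using st(3) by (cases s; cases t) (auto simp: ab_def)
    have "c \<in> Z" "c' \<in> Z" "a \<in> Z" "c \<noteq> a" "c' \<noteq> a" "slope X Y c a = slope X Y c' a"
      using st UZ[of a b c] UZ[of a b c'] by (auto simp: s sl_def slope_commute)
    then show ?thesis
      using gp[of c c' a] by (auto simp: s)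
  qed
  have inj_ac: "s = t" if st: "s \<in> U" "t \<in> U" "ac s = ac t" "xb s = xb t" for s t
  proof -
    obtain a b c b' where s: "s = (a, b, c)" "t = (a, b', c)"
      using st(3) by (cases s; cases t) (auto simp: ac_def)
    show ?thesis
      using st UZ[of a b c] UZ[of a b' c] inj_onD[OF Z(2), of b b'] by (auto simp: s xb_def)
  qed
  have RU: "R \<subseteq> U" by (auto simp: R_def)
  have low_le: "card (low S key val) \<le> card K"
    if S: "S \<subseteq> U" and key: "key ` U \<subseteq> K"
      and inj: "\<And>s t. s \<in> U \<Longrightarrow> t \<in> U \<Longrightarrow> key s = key t \<Longrightarrow> val s = val t \<Longrightarrow> s = t"
    for S key val
    unfolding low_def
  proof (rule card_fibre_minimal_le[OF K(1)])
    show "key ` S \<subseteq> K" using S key by blast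
    show "s = t" if "s \<in> S" "t \<in> S" "key s = key t" "val s = val t" for s t
      using that S inj by blast
  qed
  have le: "card (low U bc sl) \<le> card K" "card (low U bc (\<lambda>s. - sl s)) \<le> card K"
    "card (low U ab sl) \<le> card K" "card (low U ab (\<lambda>s. - sl s)) \<le> card K"
    "card (low R ac xb) \<le> card K" "card (low R ac (\<lambda>s. - xb s)) \<le> card K"
    using inj_bc inj_ab inj_ac by (intro low_le key RU order_refl; simp)+
  \<comment> \<open>A cap of \<open>R\<close> that is neither leftmost nor rightmost over
    \<open>(a, c)\<close> has neighbours \<open>s1\<close> and \<open>s3\<close> in \<open>R\<close>
    on both sides. Since their chord slopes are not extremal in \<open>U\<close>, they supply the
    points \<open>a1\<close>, \<open>a2\<close>, \<open>c1\<close>, \<open>c2\<close> of the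
    forbidden configuration.\<close>
  have "R \<subseteq> low R ac xb \<union> low R ac (\<lambda>s. - xb s)"
  proof (rule ccontr)
    assume "\<not> ?thesis"
    then obtain s where s0: "s \<in> R" "s \<notin> low R ac xb" "s \<notin> low R ac (\<lambda>s. - xb s)"
      by blast
    obtain s1 where s1: "s1 \<in> R" "ac s1 = ac s" "xb s1 < xb s"
      using s0(1,2) unfolding low_def by (force simp: not_le)
    obtain s3 where s3: "s3 \<in> R" "ac s3 = ac s" "xb s < xb s3"
      using s0(1,3) unfolding low_def by (force simp: not_le)
    note s = s0(1) s1(1) s3(1) s1(2) s3(2) s1(3) s3(3)
    obtain a b2 c b1 b3 where s_eq: "s = (a, b2, c)" "s1 = (a, b1, c)" "s3 = (a, b3, c)"
      using s(4,5) by (cases s; cases s1; cases s3) (auto simp: ac_def)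
    have nlow: "s1 \<notin> low U bc sl" "s1 \<notin> low U bc (\<lambda>s. - sl s)"
      "s3 \<notin> low U ab sl" "s3 \<notin> low U ab (\<lambda>s. - sl s)" "s1 \<in> U" "s3 \<in> U" "s \<in> U"
      using s by (auto simp: R_def)
    obtain a1 where a1: "(a1, b1, c) \<in> U" "slope X Y a1 c < slope X Y a c"
      using nlow(1,5) by (auto simp: low_def bc_def sl_def s_eq not_le)
    obtain a2 where a2: "(a2, b1, c) \<in> U" "slope X Y a c < slope X Y a2 c"
      using nlow(2,5) by (auto simp: low_def bc_def sl_def s_eq not_le)
    obtain c1 where c1: "(a, b3, c1) \<in> U" "slope X Y a c1 < slope X Y a c"
      using nlow(3,6) by (auto simp: low_def ab_def sl_def s_eq not_le)
    obtain c2 where c2: "(a, b3, c2) \<in> U" "slope X Y a c < slope X Y a c2"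
      using nlow(4,6) by (auto simp: low_def ab_def sl_def s_eq not_le)
    show False
      using no_three_surrounded_caps[of a b1 c X Y Z b2 b3 a1 a2 c1 c2] a1 a2 c1 c2 nlow s
      by (auto simp: U_def s_eq xb_def)
  qed
  then have "U \<subseteq> low U bc sl \<union> low U bc (\<lambda>s. - sl s) \<union> low U ab sl \<union> low U ab (\<lambda>s. - sl s)
      \<union> low R ac xb \<union> low R ac (\<lambda>s. - xb s)" (is "_ \<subseteq> ?W")
    unfolding R_def by blast
  moreover have "finite ?W"
    by (rule finite_subset[OF _ finU]) (auto simp: low_def R_def)
  ultimately have "card U \<le> card ?W"
    by (rule card_mono[rotated])
  also have "\<dots> \<le> card (low U bc sl) + card (low U bc (\<lambda>s. - sl s)) + card (low U ab sl)
      + card (low U ab (\<lambda>s. - sl s)) + card (low R ac xb) + card (low R ac (\<lambda>s. - xb s))"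
    by (intro card_Un_le[THEN order_trans] add_mono order_refl)
  also have "\<dots> \<le> 6 * card K"
    using le by linarith
  finally show ?thesis
    by (simp add: U_def K)
qed

section \<open>From heights and slopes to triangles in the plane\<close>

definition point_at :: "('a :: real_vector \<Rightarrow> real) \<Rightarrow> 'a \<Rightarrow> 'a \<Rightarrow> real \<Rightarrow> 'a" where
  "point_at X p q x = p + ((x - X p) / (X q - X p)) *\<^sub>R (q - p)"

lemma coords_point_at:
  assumes "linear X" "linear Y" "X p \<noteq> X q"
  shows "X (point_at X p q x) = x" "Y (point_at X p q x) = height X Y p q x"
proof -
  have "X (point_at X p q x) = X p + (x - X p) / (X q - X p) * (X q - X p)"
    by (simp only: point_at_def linear_add[OF assms(1)] linear_diff[OF assms(1)]
        linear_scale[OF assms(1)] real_scaleR_def)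
  then show "X (point_at X p q x) = x"
    using assms(3) by simp
  have "Y (point_at X p q x) = Y p + (x - X p) / (X q - X p) * (Y q - Y p)"
    by (simp only: point_at_def linear_add[OF assms(2)] linear_diff[OF assms(2)]
        linear_scale[OF assms(2)] real_scaleR_def)
  then show "Y (point_at X p q x) = height X Y p q x"
    by (simp add: height_def slope_def mult.commute)
qed

lemma point_at_in_segment:
  assumes "X p < X q" "X p \<le> x" "x \<le> X q"
  shows "point_at X p q x \<in> closed_segment p q"
proof -
  let ?t = "(x - X p) / (X q - X p)"
  have "point_at X p q x = (1 - ?t) *\<^sub>R p + ?t *\<^sub>R q"
    by (simp add: point_at_def algebra_simps)
  moreover have "0 \<le> ?t" "?t \<le> 1"
    using assms by simp_all
  ultimately show ?thesis
    unfolding closed_segment_def by blast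
qed

lemma vertical_segment:
  fixes X Y :: "'a :: real_vector \<Rightarrow> real"
  assumes XY: "linear X" "linear Y" "\<And>v. X v = 0 \<Longrightarrow> Y v = 0 \<Longrightarrow> v = 0"
    and p: "X p = X r" "X q = X r" "Y p \<le> Y r" "Y r \<le> Y q"
  shows "r \<in> closed_segment p q"
proof (cases "Y p = Y q")
  case True
  then have "r - p = 0"
    by (intro XY(3)) (use p in \<open>auto simp: linear_diff XY\<close>)
  then show ?thesis by simp
next
  case False
  then have lt: "Y p < Y q" using p by simp
  \<comment> \<open>Here \<open>Y\<close> serves as the parameter along the segment: the point of
    \<open>pq\<close> at level \<open>Y r\<close> agrees with \<open>r\<close> in both
    coordinates.\<close>
  have "point_at Y p q (Y r) - r = 0"
  proof (rule XY(3))
    show "X (point_at Y p q (Y r) - r) = 0"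
      using p by (simp add: point_at_def linear_add linear_diff linear_scale XY)
    show "Y (point_at Y p q (Y r) - r) = 0"
      using coords_point_at(1)[OF XY(2,2)] lt by (simp add: linear_diff XY)
  qed
  then have "point_at Y p q (Y r) = r" by simp
  then show ?thesis
    using point_at_in_segment[of Y p q "Y r"] lt p by simp
qed

text \<open>The vertical line through \<open>r\<close> meets the chord \<open>ac\<close> at or below
  \<open>r\<close> and an upper side at or above \<open>r\<close>. Both points lie in the hull,
  hence so does \<open>r\<close>.\<close>

lemma under_cap_in_triangle:
  assumes XY: "linear X" "linear Y" "\<And>v. X v = 0 \<Longrightarrow> Y v = 0 \<Longrightarrow> v = 0"
    and abc: "X a < X b" "X b < X c" "under_cap X Y a b c (X r) (Y r)"
  shows "r \<in> convex hull {a, b, c}"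
proof -
  let ?p = "point_at X a c (X r)"
  have *: "closed_segment p q \<subseteq> convex hull {a, b, c}"
    if "p \<in> convex hull {a, b, c}" "q \<in> convex hull {a, b, c}" for p q
    using that by (simp add: closed_segment_subset_convex_hull)
  have v: "a \<in> convex hull {a, b, c}" "b \<in> convex hull {a, b, c}" "c \<in> convex hull {a, b, c}"
    by (simp_all add: hull_inc)
  have r: "X a \<le> X r" "X r \<le> X c"
    using abc by (auto simp: under_cap_def)
  have p: "?p \<in> convex hull {a, b, c}" "X ?p = X r" "Y ?p \<le> Y r"
    using point_at_in_segment[of X a c "X r"] *[OF v(1,3)] r abc coords_point_at[OF XY(1,2), of a c "X r"]
    by (auto simp: under_cap_def)
  obtain q where "q \<in> convex hull {a, b, c}" "X q = X r" "Y r \<le> Y q"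
  proof (cases "X r \<le> X b \<and> Y r \<le> height X Y a b (X r)")
    case True
    then show ?thesis
      using point_at_in_segment[of X a b "X r"] *[OF v(1,2)] r abc
        coords_point_at[OF XY(1,2), of a b "X r"] that[of "point_at X a b (X r)"]
      by auto
  next
    case False
    then show ?thesis
      using point_at_in_segment[of X b c "X r"] *[OF v(2,3)] r abc
        coords_point_at[OF XY(1,2), of b c "X r"] that[of "point_at X b c (X r)"]
      by (auto simp: under_cap_def)
  qed
  then show ?thesis
    using vertical_segment[OF XY, of ?p r q] * p by blast
qed

lemma collinear_if_slope_eq:
  fixes p q r :: "'a :: real_vector"
  assumes XY: "linear X" "linear Y" "\<And>v. X v = 0 \<Longrightarrow> Y v = 0 \<Longrightarrow> v = 0"
    and "X p \<noteq> X r" "X q \<noteq> X r" "slope X Y p r = slope X Y q r"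
  obtains t where "q - r = t *\<^sub>R (p - r)"
proof -
  let ?t = "(X q - X r) / (X p - X r)"
  have "(q - r) - ?t *\<^sub>R (p - r) = 0"
  proof (rule XY(3))
    have "X ((q - r) - ?t *\<^sub>R (p - r)) = (X q - X r) - ?t * (X p - X r)"
      by (simp only: linear_diff[OF XY(1)] linear_scale[OF XY(1)] real_scaleR_def)
    then show "X ((q - r) - ?t *\<^sub>R (p - r)) = 0"
      using assms(4) by simp
    have nz: "X p - X r \<noteq> 0" "X q - X r \<noteq> 0" using assms(4,5) by auto
    have "(Y r - Y p) / (X r - X p) = (Y r - Y q) / (X r - X q)"
      using assms(6) by (simp add: slope_def)
    then have "(Y p - Y r) / (X p - X r) = (Y q - Y r) / (X q - X r)"
      by (metis minus_diff_eq minus_divide_divide)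
    then have "Y q - Y r = ?t * (Y p - Y r)"
      using nz by (simp add: frac_eq_eq mult.commute)
    moreover have "Y ((q - r) - ?t *\<^sub>R (p - r)) = (Y q - Y r) - ?t * (Y p - Y r)"
      by (simp only: linear_diff[OF XY(2)] linear_scale[OF XY(2)] real_scaleR_def)
    ultimately show "Y ((q - r) - ?t *\<^sub>R (p - r)) = 0"
      by simp
  qed
  then show thesis
    using that[of ?t] by simp
qed

text \<open>Membership in the hull replaces the comparison of heights, so one notion covers caps for
  \<open>Y\<close> and for \<open>- Y\<close>. The triple \<open>(u, v, w)\<close> stands for the
  candidate above or below \<open>u\<close> on \<open>vw\<close>.\<close>

definition pierced :: "(real ^ 2 \<Rightarrow> real) \<Rightarrow> (real ^ 2) set \<Rightarrow> (real ^ 2) set \<Rightarrow>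
    (real ^ 2) \<times> (real ^ 2) \<times> (real ^ 2) \<Rightarrow> bool" where
  "pierced X Z T = (\<lambda>(u, v, w). u \<in> Z - T \<and> v \<in> Z - T \<and> w \<in> Z - T \<and>
     X v < X u \<and> X u < X w \<and> point_at X v w (X u) \<in> convex hull T)"

lemma sorted_triple:
  fixes X :: "'a \<Rightarrow> real"
  assumes "X x \<noteq> X y" "X y \<noteq> X z" "X x \<noteq> X z"
  obtains a b c where "{x, y, z} = {a, b, c}" "X a < X b" "X b < X c"
proof -
  consider "X x < X y" "X y < X z" | "X x < X z" "X z < X y" | "X y < X x" "X x < X z"
    | "X y < X z" "X z < X x" | "X z < X x" "X x < X y" | "X z < X y" "X y < X x"
    using assms by linarith
  then show thesis
    by cases (use that in \<open>auto simp: insert_commute\<close>)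
qed

text \<open>Sorted by \<open>X\<close>, an unpierced triangle is an empty cap either for
  \<open>Y\<close> or for \<open>- Y\<close>; each orientation contributes 6 times the
  square.\<close>

lemma card_unpierced_triangles_le:
  fixes X Y :: "real ^ 2 \<Rightarrow> real" and Z :: "(real ^ 2) set"
  assumes XY: "linear X" "linear Y" "\<And>v. X v = 0 \<Longrightarrow> Y v = 0 \<Longrightarrow> v = 0"
    and Z: "finite Z" "general_position Z" "inj_on X Z"
  shows "card {T. T \<subseteq> Z \<and> card T = 3 \<and> (\<forall>s. \<not> pierced X Z T s)} \<le> 12 * (card Z)\<^sup>2"
proof -
  let ?Y = "\<lambda>v. - Y v"
  have XY': "linear ?Y" "\<And>v. X v = 0 \<Longrightarrow> ?Y v = 0 \<Longrightarrow> v = 0"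
    using XY by (auto intro: linear_compose_neg)
  have gp: "slope X Y' p r \<noteq> slope X Y' q r"
    if Y': "linear Y'" "\<And>v. X v = 0 \<Longrightarrow> Y' v = 0 \<Longrightarrow> v = 0"
      and pqr: "p \<in> Z" "q \<in> Z" "r \<in> Z" "p \<noteq> q" "p \<noteq> r" "q \<noteq> r" for Y' p q r
  proof
    assume eq: "slope X Y' p r = slope X Y' q r"
    have "X p \<noteq> X r" "X q \<noteq> X r"
      using Z pqr by (auto dest: inj_onD)
    then obtain t where "q - r = t *\<^sub>R (p - r)"
      using collinear_if_slope_eq[OF XY(1) Y' _ _ eq] by blast
    then have "collinear {p, r, q}"
      by (auto simp: collinear_3 collinear_lemma)
    moreover have "card {p, r, q} = 3" "{p, r, q} \<subseteq> Z"
      using pqr by auto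
    ultimately show False
      using Z(2) unfolding general_position_def by metis
  qed
  define U where "U = empty_caps X Y Z \<union> empty_caps X ?Y Z"
  have fin: "finite U"
    by (rule finite_subset[of _ "Z \<times> Z \<times> Z"]) (use Z in \<open>auto simp: U_def empty_caps_def caps_def\<close>)
  have "card U \<le> card (empty_caps X Y Z) + card (empty_caps X ?Y Z)"
    unfolding U_def by (rule card_Un_le)
  also have "\<dots> \<le> 12 * (card Z)\<^sup>2"
    using card_empty_caps_le[of Z X Y] card_empty_caps_le[of Z X ?Y] Z gp XY XY' by fastforce
  finally have U: "card U \<le> 12 * (card Z)\<^sup>2" .
  have "{T. T \<subseteq> Z \<and> card T = 3 \<and> (\<forall>s. \<not> pierced X Z T s)} \<subseteq> (\<lambda>(a, b, c). {a, b, c}) ` U"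
  proof
    fix T assume "T \<in> {T. T \<subseteq> Z \<and> card T = 3 \<and> (\<forall>s. \<not> pierced X Z T s)}"
    then have T: "T \<subseteq> Z" "card T = 3" "\<And>s. \<not> pierced X Z T s" by auto
    obtain x y z where xyz: "T = {x, y, z}" "x \<noteq> y" "y \<noteq> z" "x \<noteq> z"
      using T(2) by (auto simp: card_3_iff)
    then have "X x \<noteq> X y" "X y \<noteq> X z" "X x \<noteq> X z"
      using Z(3) T(1) by (auto dest: inj_onD)
    then obtain a b c where abc: "T = {a, b, c}" "X a < X b" "X b < X c"
      using sorted_triple[of X x y z] unfolding xyz(1) by metis
    then have abcZ: "a \<in> Z" "b \<in> Z" "c \<in> Z" "a \<noteq> b" "a \<noteq> c" "b \<noteq> c"
      using T(1) by auto
    have empty: "(a, b, c) \<in> empty_caps X Y' Z"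
      if Y': "linear Y'" "\<And>v. X v = 0 \<Longrightarrow> Y' v = 0 \<Longrightarrow> v = 0" and "height X Y' a c (X b) < Y' b" for Y'
    proof -
      have "\<not> under_cap X Y' a b c (X u) (height X Y' v w (X u))"
        if uvw: "u \<in> Z - T" "v \<in> Z - T" "w \<in> Z - T" "X v < X u" "X u < X w" for u v w
      proof
        assume "under_cap X Y' a b c (X u) (height X Y' v w (X u))"
        then have "point_at X v w (X u) \<in> convex hull T"
          using under_cap_in_triangle[OF XY(1) Y' abc(2,3), of "point_at X v w (X u)"]
            coords_point_at[OF XY(1) Y'(1), of v w "X u"] uvw by (simp add: abc(1))
        then show False
          using T(3)[of "(u, v, w)"] uvw by (simp add: pierced_def)
      qed
      then show ?thesis
        using that abc abcZ by (auto simp: empty_caps_def caps_def)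
    qed
    \<comment> \<open>General position keeps \<open>b\<close> off the line \<open>ac\<close>, so one
      of the two orientations makes it a top.\<close>
    have "slope X Y b a \<noteq> slope X Y c a"
      using gp[OF XY(2,3)] abcZ by metis
    then have "slope X Y a b \<noteq> slope X Y a c"
      by (simp add: slope_commute)
    then have "height X Y a c (X b) \<noteq> Y b"
      using abc by (auto simp: height_def slope_def field_simps)
    moreover have "slope X ?Y a c = - slope X Y a c"
      by (simp add: slope_def minus_divide_left)
    then have "height X ?Y a c (X b) = - height X Y a c (X b)"
      by (simp add: height_def)
    ultimately have "height X Y a c (X b) < Y b \<or> height X ?Y a c (X b) < ?Y b"
      by linarith
    then have "(a, b, c) \<in> U"
      using empty[OF XY(2,3)] empty[OF XY'] by (auto simp: U_def)
    then show "T \<in> (\<lambda>(a, b, c). {a, b, c}) ` U"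
      using abc(1) by force
  qed
  then have "card {T. T \<subseteq> Z \<and> card T = 3 \<and> (\<forall>s. \<not> pierced X Z T s)} \<le> card U"
    using fin by (rule surj_card_le[rotated])
  with U show ?thesis by simp
qed

section \<open>Random sampling, done by counting\<close>

text \<open>A function \<open>f\<close> into \<open>{..<q}\<close> encodes the sample of all
  vertices with \<open>f x = 0\<close>. Counting functions thus models independent choices with
  probability 1/q: a fixed \<open>S\<close> survives in a fraction \<open>1 / q ^ card S\<close> of
  the samples.\<close>

lemma card_PiE_zero_on:
  assumes "finite V" "S \<subseteq> V" "q \<ge> (1 :: nat)"
  shows "real (card {f \<in> V \<rightarrow>\<^sub>E {..<q}. \<forall>x\<in>S. f x = 0}) = real q ^ card V / real q ^ card S"
proof -
  have "{f \<in> V \<rightarrow>\<^sub>E {..<q}. \<forall>x\<in>S. f x = 0} = (\<Pi>\<^sub>E x\<in>V. if x \<in> S then {0} else {..<q})"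
  proof (intro set_eqI iffI)
    fix f assume "f \<in> (\<Pi>\<^sub>E x\<in>V. if x \<in> S then {0} else {..<q})"
    then have f: "f x \<in> (if x \<in> S then {0} else {..<q})" "f \<in> extensional V" if "x \<in> V" for x
      using that by (auto simp: PiE_iff)
    then have "f x < q" if "x \<in> V" for x
      using f(1)[OF that] assms(3) by (auto split: if_splits)
    moreover have "f x = 0" if "x \<in> S" for x
      using f(1)[of x] that assms(2) by auto
    ultimately show "f \<in> {f \<in> V \<rightarrow>\<^sub>E {..<q}. \<forall>x\<in>S. f x = 0}"
      using \<open>f \<in> _\<close> by (auto simp: PiE_iff)
  qed (use assms in \<open>auto simp: PiE_iff\<close>)
  then have "card {f \<in> V \<rightarrow>\<^sub>E {..<q}. \<forall>x\<in>S. f x = 0} = (\<Prod>x\<in>V. if x \<in> S then 1 else q)"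
    using assms by (simp add: card_PiE if_distrib cong: if_cong)
  also have "\<dots> = q ^ (card V - card S)"
    using assms by (simp add: prod.If_cases card_Diff_subset finite_subset
        Diff_eq[symmetric] inf.absorb2)
  finally have "real (card {f \<in> V \<rightarrow>\<^sub>E {..<q}. \<forall>x\<in>S. f x = 0}) = real q ^ (card V - card S)"
    by simp
  then show ?thesis
    using assms power_diff[of "real q" "card S" "card V"] by (simp add: card_mono)
qed

text \<open>This is linearity of expectation, multiplied by the number of samples.\<close>

lemma sum_card_sampled:
  assumes "finite V" "finite I" "\<And>i. i \<in> I \<Longrightarrow> s i \<subseteq> V" "q \<ge> (1 :: nat)"
  shows "(\<Sum>f \<in> V \<rightarrow>\<^sub>E {..<q}. real (card {i \<in> I. s i \<subseteq> {x \<in> V. f x = 0}})) =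
    real q ^ card V * (\<Sum>i\<in>I. 1 / real q ^ card (s i))"
proof -
  let ?F = "V \<rightarrow>\<^sub>E {..<q}"
  have F: "finite ?F" using assms by (simp add: finite_PiE)
  have "(\<Sum>f\<in>?F. real (card {i \<in> I. s i \<subseteq> {x \<in> V. f x = 0}})) =
      (\<Sum>f\<in>?F. \<Sum>i\<in>I. if s i \<subseteq> {x \<in> V. f x = 0} then 1 else 0)"
    using assms by (simp add: sum.If_cases Int_def)
  also have "\<dots> = (\<Sum>i\<in>I. \<Sum>f\<in>?F. if s i \<subseteq> {x \<in> V. f x = 0} then 1 else 0)"
    by (rule sum.swap)
  also have "\<dots> = (\<Sum>i\<in>I. real q ^ card V / real q ^ card (s i))"
  proof (rule sum.cong)
    fix i assume "i \<in> I"
    then have "{f \<in> ?F. s i \<subseteq> {x \<in> V. f x = 0}} = {f \<in> ?F. \<forall>x\<in>s i. f x = 0}"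
      using assms(3) by blast
    then show "(\<Sum>f\<in>?F. if s i \<subseteq> {x \<in> V. f x = 0} then 1 else 0) =
        real q ^ card V / real q ^ card (s i)"
      using F assms \<open>i \<in> I\<close> card_PiE_zero_on[of V "s i" q] by (simp add: sum.If_cases Int_def)
  qed simp
  finally show ?thesis
    by (simp add: sum_distrib_left)
qed

text \<open>The assumed bound is averaged over all samples. Members of \<open>E\<close> survive with
  probability q^-3 and supports of \<open>H\<close> with probability q^-6, while the mean of the
  squared sample size is at most 2 n^2 / q^2. Multiplication by q^6 gives the claim.\<close>

lemma sampling_amplification:
  fixes V :: "'a set" and supp :: "'b \<Rightarrow> 'a set" and c q :: nat
  assumes V: "finite V" and E: "finite E" "\<And>T. T \<in> E \<Longrightarrow> T \<subseteq> V \<and> card T = 3"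
    and H: "finite H" "\<And>h. h \<in> H \<Longrightarrow> supp h \<subseteq> V \<and> card (supp h) = 6"
    and Z: "\<And>Z. Z \<subseteq> V \<Longrightarrow>
      card {T \<in> E. T \<subseteq> Z} \<le> c * (card Z)\<^sup>2 + card {h \<in> H. supp h \<subseteq> Z}"
    and q: "1 \<le> q" "q \<le> card V"
  shows "real (card E) * real q ^ 3 \<le> 2 * real c * (real (card V))\<^sup>2 * real q ^ 4 + real (card H)"
proof -
  let ?F = "V \<rightarrow>\<^sub>E {..<q}" and ?Z = "\<lambda>f. {x \<in> V. f x = (0 :: nat)}"
  let ?P = "\<lambda>i. {fst i, snd i}"
  define n where "n = real (card V)"
  define Q where "Q = real q"
  have Q: "1 \<le> Q" "Q \<le> n" using q by (auto simp: n_def Q_def)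
  \<comment> \<open>A pair with distinct entries survives with probability 1/Q^2, a diagonal pair
    with 1/Q. The diagonal total n/Q is absorbed into n^2/Q^2 because q is at most n.\<close>
  have "(\<Sum>i\<in>V \<times> V. 1 / Q ^ card (?P i)) \<le>
      (\<Sum>i\<in>V \<times> V. 1 / Q\<^sup>2 + (if i \<in> (\<lambda>x. (x, x)) ` V then 1 / Q else 0))"
    using Q by (intro sum_mono) (auto simp: card_insert_if power2_eq_square)
  also have "\<dots> = n\<^sup>2 / Q\<^sup>2 + (\<Sum>i \<in> (V \<times> V) \<inter> (\<lambda>x. (x, x)) ` V. 1 / Q)"
    using V by (subst sum.distrib, subst sum.inter_restrict[symmetric])
      (auto simp: n_def card_cartesian_product power2_eq_square)
  also have "(V \<times> V) \<inter> (\<lambda>x. (x, x)) ` V = (\<lambda>x. (x, x)) ` V" by auto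
  also have "(\<Sum>i \<in> (\<lambda>x. (x, x)) ` V. 1 / Q) = n / Q"
    by (simp add: card_image inj_on_def n_def)
  also have "n / Q \<le> n\<^sup>2 / Q\<^sup>2"
    using Q by (simp add: field_simps power2_eq_square mult_mono)
  finally have pairs: "(\<Sum>i\<in>V \<times> V. 1 / Q ^ card (?P i)) \<le> 2 * n\<^sup>2 / Q\<^sup>2" by simp
  \<comment> \<open>The squared sample size counts surviving ordered pairs, which makes it
    accessible to \<open>sum_card_sampled\<close>.\<close>
  have sq: "(card (?Z f))\<^sup>2 = card {i \<in> V \<times> V. ?P i \<subseteq> ?Z f}" for f
  proof -
    have "{i \<in> V \<times> V. ?P i \<subseteq> ?Z f} = ?Z f \<times> ?Z f" by auto
    then show ?thesis by (simp add: card_cartesian_product power2_eq_square)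
  qed
  have "Q ^ card V * (\<Sum>T\<in>E. 1 / Q ^ card T) = (\<Sum>f\<in>?F. real (card {T \<in> E. T \<subseteq> ?Z f}))"
    using sum_card_sampled[of V E "\<lambda>T. T" q] V E q unfolding Q_def by simp
  also have "\<dots> \<le> (\<Sum>f\<in>?F. real c * real (card {i \<in> V \<times> V. ?P i \<subseteq> ?Z f})
      + real (card {h \<in> H. supp h \<subseteq> ?Z f}))"
  proof (rule sum_mono)
    fix f
    show "real (card {T \<in> E. T \<subseteq> ?Z f}) \<le> real c * real (card {i \<in> V \<times> V. ?P i \<subseteq> ?Z f})
        + real (card {h \<in> H. supp h \<subseteq> ?Z f})"
      using Z[of "?Z f"] unfolding sq of_nat_mult[symmetric] of_nat_add[symmetric] of_nat_le_iff
      by blast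
  qed
  also have "\<dots> = Q ^ card V *
      (real c * (\<Sum>i\<in>V \<times> V. 1 / Q ^ card (?P i)) + (\<Sum>h\<in>H. 1 / Q ^ card (supp h)))"
  proof -
    have "?P i \<subseteq> V" if "i \<in> V \<times> V" for i using that by auto
    then have P: "(\<Sum>f\<in>?F. real (card {i \<in> V \<times> V. ?P i \<subseteq> ?Z f})) =
        Q ^ card V * (\<Sum>i\<in>V \<times> V. 1 / Q ^ card (?P i))"
      using sum_card_sampled[of V "V \<times> V" ?P q] V q(1) unfolding Q_def by (simp only: finite_cartesian_product)
    have S: "(\<Sum>f\<in>?F. real (card {h \<in> H. supp h \<subseteq> ?Z f})) =
        Q ^ card V * (\<Sum>h\<in>H. 1 / Q ^ card (supp h))"
      using sum_card_sampled[of V H supp q] V H q(1) unfolding Q_def by blast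
    show ?thesis
      unfolding sum.distrib sum_distrib_left[symmetric] P S by (simp only: distrib_left ac_simps)
  qed
  finally have "(\<Sum>T\<in>E. 1 / Q ^ card T) \<le>
      real c * (\<Sum>i\<in>V \<times> V. 1 / Q ^ card (?P i)) + (\<Sum>h\<in>H. 1 / Q ^ card (supp h))"
    using Q by simp
  also have "\<dots> \<le> real c * (2 * n\<^sup>2 / Q\<^sup>2) + (\<Sum>h\<in>H. 1 / Q ^ card (supp h))"
    using pairs by (intro add_mono mult_left_mono) auto
  also have "(\<Sum>h\<in>H. 1 / Q ^ card (supp h)) = real (card H) / Q ^ 6"
    using H by simp
  also have "(\<Sum>T\<in>E. 1 / Q ^ card T) = real (card E) / Q ^ 3"
    using E by simp
  finally have "real (card E) / Q ^ 3 * Q ^ 6 \<le> (real c * (2 * n\<^sup>2 / Q\<^sup>2) + real (card H) / Q ^ 6) * Q ^ 6"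
    using Q by (intro mult_right_mono) auto
  moreover have "real (card E) / Q ^ 3 * Q ^ 6 = real (card E) * Q ^ 3"
    using Q by (simp add: field_simps flip: power_add)
  moreover have "(real c * (2 * n\<^sup>2 / Q\<^sup>2) + real (card H) / Q ^ 6) * Q ^ 6
      = 2 * real c * n\<^sup>2 * Q ^ 4 + real (card H)"
    using Q by (simp add: field_simps flip: power_add)
  ultimately show ?thesis
    by (simp add: n_def Q_def)
qed

section \<open>Families of triples without k disjoint members\<close>

lemma card_triples_le_of_no_disjoint:
  fixes V :: "'a set"
  assumes V: "finite V" and F: "\<And>T. T \<in> F \<Longrightarrow> T \<subseteq> V \<and> card T = 3"
    and no: "\<And>D. D \<subseteq> F \<Longrightarrow> pairwise disjnt D \<Longrightarrow> card D \<noteq> k"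
  shows "card F \<le> 3 * k * (card V)\<^sup>2"
proof -
  have finF: "finite F"
    by (rule finite_subset[of _ "Pow V"]) (use V F in auto)
  let ?P = "\<lambda>D. D \<subseteq> F \<and> pairwise disjnt D"
  \<comment> \<open>A disjoint subfamily of largest size: its union has at most 3k points and meets
    every triple of \<open>F\<close>.\<close>
  have "\<exists>D. ?P D \<and> (\<forall>D'. ?P D' \<longrightarrow> card D' \<le> card D)"
    by (rule ex_has_greatest_nat[of ?P "{}" card "Suc (card F)"])
      (use finF in \<open>auto intro: card_mono le_imp_less_Suc\<close>)
  then obtain D where D: "D \<subseteq> F" "pairwise disjnt D"
    and max: "\<And>D'. D' \<subseteq> F \<Longrightarrow> pairwise disjnt D' \<Longrightarrow> card D' \<le> card D" by blast
  have finD: "finite D" using D finF finite_subset by blast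
  have "card D < k"
  proof (rule ccontr)
    assume "\<not> card D < k"
    then obtain D' where "D' \<subseteq> D" "card D' = k"
      by (meson not_less obtain_subset_with_card_n)
    then show False
      using no[of D'] D pairwise_subset by blast
  qed
  let ?W = "\<Union>D"
  have W: "?W \<subseteq> V" using D F by blast
  have "card ?W \<le> (\<Sum>T\<in>D. card T)"
    by (rule card_Union_le_sum_card)
  also have "\<dots> = card D * 3"
    using D F by (simp add: subset_iff)
  finally have cW: "card ?W \<le> 3 * k" using \<open>card D < k\<close> by simp
  \<comment> \<open>A triple is recovered from a point that it shares with the union and its two
    other vertices.\<close>
  have "F \<subseteq> (\<lambda>(x, y, z). {x, y, z}) ` (?W \<times> V \<times> V)"
  proof
    fix T assume T: "T \<in> F"
    have "T \<inter> ?W \<noteq> {}"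
    proof
      assume dis: "T \<inter> ?W = {}"
      have "T \<noteq> {}" using F[OF T] by auto
      then have "T \<notin> D" using dis by blast
      moreover have "pairwise disjnt (insert T D)"
        using D dis by (auto simp: pairwise_insert disjnt_def)
      ultimately show False
        using max[of "insert T D"] T D finD by simp
    qed
    then obtain x where x: "x \<in> T" "x \<in> ?W" by blast
    have "card (T - {x}) = 2" using F[OF T] x by (simp add: card_Diff_singleton)
    then obtain y z where "T - {x} = {y, z}" by (auto simp: card_2_iff)
    then have "T = {x, y, z}" using x by auto
    then show "T \<in> (\<lambda>(x, y, z). {x, y, z}) ` (?W \<times> V \<times> V)"
      using x F[OF T] by force
  qed
  then have "card F \<le> card (?W \<times> V \<times> V)"
    using V finite_subset[OF W V] by (intro surj_card_le) auto
  also have "\<dots> \<le> 3 * k * (card V)\<^sup>2"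
    using cW by (simp add: card_cartesian_product power2_eq_square)
  finally show ?thesis .
qed

section \<open>Choice of the sampling rate\<close>

text \<open>With q near m / (96 n^2) the term 24 n^2 q^4 is at most a quarter of m q^3, which leaves
  m q^3 <= 4 k n^5 and hence m^4 = O(k n^11). If m < 96 n^2, the bound is immediate.\<close>

lemma bound_of_sampling:
  fixes m n k :: nat
  assumes n: "1 \<le> n" "m \<le> n ^ 3"
    and q: "\<And>q. 1 \<le> q \<Longrightarrow> q \<le> n \<Longrightarrow>
      real m * real q ^ 3 \<le> 24 * (real n)\<^sup>2 * real q ^ 4 + 3 * real k * real n ^ 5"
  shows "real m \<le> (96 + 4 * real k * 192 ^ 3) * real n powr (11 / 4)"
proof -
  define M N where "M = real m" and "N = real n"
  \<comment> \<open>The factor 192^3 is 8 * 96^3: 96 from the rate, and 2^3 from rounding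
    \<open>r\<close> down to \<open>q\<close>.\<close>
  define K where "K = 4 * real k * 192 ^ 3"
  have N: "1 \<le> N" and M: "0 \<le> M" using n by (auto simp: M_def N_def)
  have NP: "0 \<le> N powr (11 / 4)" by simp
  show ?thesis
  proof (cases "M < 96 * N\<^sup>2")
    case True
    have "N\<^sup>2 = N powr 2" using N by simp
    also have "\<dots> \<le> N powr (11 / 4)" using N by (intro powr_mono) auto
    finally have "M \<le> 96 * N powr (11 / 4)" using True by simp
    also have "\<dots> \<le> (96 + K) * N powr (11 / 4)"
      by (intro mult_right_mono) (auto simp: K_def)
    finally show ?thesis by (simp add: M_def N_def K_def)
  next
    case False
    define r where "r = M / (96 * N\<^sup>2)"
    define q where "q = nat \<lfloor>r\<rfloor>"
    have r: "1 \<le> r" using False N by (simp add: r_def)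
    have "1 \<le> \<lfloor>r\<rfloor>" using r by simp
    then have q_floor: "real q = of_int \<lfloor>r\<rfloor>" and "1 \<le> q" by (simp_all add: q_def le_nat_iff)
    \<comment> \<open>Rounding down loses at most a factor 2, since \<open>r\<close> is at least
      1.\<close>
    have qr: "real q \<le> r" "r \<le> 2 * real q" "1 \<le> q"
      using \<open>1 \<le> \<lfloor>r\<rfloor>\<close> \<open>1 \<le> q\<close> floor_correct[of r] unfolding q_floor by linarith+
    \<comment> \<open>The trivial bound on m ensures that the chosen \<open>q\<close> does not
      exceed n.\<close>
    have "M \<le> N ^ 3"
      using n(2) unfolding M_def N_def by (metis of_nat_le_iff of_nat_power)
    then have "r \<le> N ^ 3 / N\<^sup>2"
      unfolding r_def using N M by (intro frac_le) auto
    also have "\<dots> = N" using N by (simp add: power2_eq_square power3_eq_cube)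
    finally have "real q \<le> N" using qr(1) by simp
    then have "q \<le> n" by (simp add: N_def)
    then have *: "M * real q ^ 3 \<le> 24 * N\<^sup>2 * real q ^ 4 + 3 * real k * N ^ 5"
      using q[OF qr(3)] by (simp add: M_def N_def)
    have Mr: "M = 96 * N\<^sup>2 * r" using N by (simp add: r_def)
    have "24 * N\<^sup>2 * real q ^ 4 = 24 * N\<^sup>2 * real q * real q ^ 3"
      by (simp add: power4_eq_xxxx power3_eq_cube)
    also have "\<dots> \<le> 24 * N\<^sup>2 * r * real q ^ 3"
      using qr(1) by (intro mult_right_mono mult_left_mono) auto
    also have "\<dots> = M * real q ^ 3 / 4" by (simp add: Mr)
    finally have **: "M * real q ^ 3 \<le> 4 * real k * N ^ 5" using * by linarith
    have "M * r ^ 3 \<le> M * (2 * real q) ^ 3"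
      using M r qr(2) by (intro mult_left_mono power_mono) auto
    also have "\<dots> = 8 * (M * real q ^ 3)" by (simp add: power_mult_distrib)
    also have "\<dots> \<le> 8 * (4 * real k * N ^ 5)" using ** by simp
    finally have "M * r ^ 3 * (96 * N\<^sup>2) ^ 3 \<le> 8 * (4 * real k * N ^ 5) * (96 * N\<^sup>2) ^ 3"
      by (intro mult_right_mono) auto
    also have "\<dots> = K * N ^ 11"
      by (simp add: K_def power_mult_distrib flip: power_mult power_add)
    also have "M * r ^ 3 * (96 * N\<^sup>2) ^ 3 = M ^ 4"
      using N by (simp add: r_def power_divide power4_eq_xxxx power3_eq_cube)
    finally have M4: "M ^ 4 \<le> K * N ^ 11" .
    \<comment> \<open>Only k = 0 gives K < 1, and then m = 0, contrary to the present case. With K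
      at least 1, its fourth root is at most K.\<close>
    have K1: "1 \<le> K"
    proof (rule ccontr)
      assume "\<not> 1 \<le> K"
      then have "k = 0" by (cases k) (auto simp: K_def)
      then have "M ^ 4 \<le> 0" using M4 by (simp add: K_def)
      then show False using False N M by (auto simp: power2_eq_square mult_le_0_iff)
    qed
    have "M = M powr (4 * (1 / 4))"
      using M by simp
    also have "\<dots> = (M ^ 4) powr (1 / 4)"
      using M unfolding powr_powr[symmetric] by simp
    also have "\<dots> \<le> (K * N ^ 11) powr (1 / 4)"
      using M4 by (intro powr_mono2) auto
    also have "\<dots> = K powr (1 / 4) * (N powr 11) powr (1 / 4)"
      using N K1 by (simp add: powr_mult)
    also have "\<dots> = K powr (1 / 4) * N powr (11 / 4)"
      unfolding powr_powr by simp
    also have "\<dots> \<le> (96 + K) * N powr (11 / 4)"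
    proof (intro mult_right_mono)
      have "K powr (1 / 4) \<le> K powr 1" using K1 by (intro powr_mono) auto
      then show "K powr (1 / 4) \<le> 96 + K" using K1 by simp
    qed simp
    finally show ?thesis by (simp add: M_def N_def K_def)
  qed
qed

section \<open>Application to geometric hypergraphs\<close>

lemma exists_generic_projection:
  fixes V :: "(real ^ 2) set"
  assumes "finite V"
  obtains t where "inj_on (\<lambda>p. p $ 1 + t * p $ 2) V"
proof -
  \<comment> \<open>Two points with different second coordinates collide for exactly one
    \<open>t\<close>. Pairs with equal second coordinates contribute only 0, the value of division
    by zero.\<close>
  let ?B = "(\<lambda>(p, q). (q $ 1 - p $ 1) / (p $ 2 - q $ 2)) ` (V \<times> V)"
  obtain t where t: "t \<notin> ?B"
    using ex_new_if_finite[OF infinite_UNIV_char_0, of ?B] assms by auto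
  have "inj_on (\<lambda>p. p $ 1 + t * p $ 2) V"
  proof (rule inj_onI)
    fix p q assume pq: "p \<in> V" "q \<in> V" "p $ 1 + t * p $ 2 = q $ 1 + t * q $ 2"
    have "p $ 2 = q $ 2"
    proof (rule ccontr)
      assume "p $ 2 \<noteq> q $ 2"
      then have "t = (q $ 1 - p $ 1) / (p $ 2 - q $ 2)"
        using pq(3) by (simp add: field_simps)
      then show False using t pq(1,2) by force
    qed
    with pq(3) show "p = q"
      by (simp add: vec_eq_iff forall_2)
  qed
  then show thesis by (rule that)
qed

lemma card_edges_le:
  assumes G: "geometric_3_hypergraph V E" "\<not> contains_strongly_crossing k V E"
    and V1: "1 \<le> card V"
  shows "real (card E) \<le> (96 + 4 * real k * 192 ^ 3) * real (card V) powr (11 / 4)"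
proof -
  define n where "n = card V"
  have V: "finite V" "general_position V"
    and E: "\<And>e. e \<in> E \<Longrightarrow> \<exists>T \<subseteq> V. card T = 3 \<and> e = convex hull T"
    using G(1) by (auto simp: geometric_3_hypergraph_def)
  \<comment> \<open>From here on edges are represented by their vertex triples;
    \<open>hull_inj\<close> allows passing back.\<close>
  define \<T> where "\<T> = {T. T \<subseteq> V \<and> card T = 3 \<and> convex hull T \<in> E}"
  have fin: "finite \<T>"
    by (rule finite_subset[of _ "Pow V"]) (use V in \<open>auto simp: \<T>_def\<close>)
  have "E \<subseteq> (\<lambda>T. convex hull T) ` \<T>"
    using E by (force simp: \<T>_def)
  then have EcT: "card E \<le> card \<T>"
    using fin surj_card_le by blast
  have hull_inj: "edge_vertices V (convex hull T) = T" if "T \<in> \<T>" for T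
    using that V edge_vertices_convex_hull by (auto simp: \<T>_def)
  define F where "F x = {T \<in> \<T>. x \<in> convex hull T}" for x
  \<comment> \<open>Disjoint triples whose hulls contain \<open>x\<close> are strongly crossing
    edges, so there are never k of them.\<close>
  have cF: "card (F x) \<le> 3 * k * n\<^sup>2" for x
    unfolding n_def
  proof (rule card_triples_le_of_no_disjoint[OF V(1)])
    show "T \<subseteq> V \<and> card T = 3" if "T \<in> F x" for T
      using that by (simp add: F_def \<T>_def)
    show "card D \<noteq> k" if D: "D \<subseteq> F x" "pairwise disjnt D" for D
    proof
      assume "card D = k"
      let ?D = "(\<lambda>T. convex hull T) ` D"
      have DT: "D \<subseteq> \<T>" using D(1) by (auto simp: F_def)
      have "inj_on (\<lambda>T. convex hull T) D"
        by (rule inj_on_inverseI[where g = "edge_vertices V"]) (use DT hull_inj in blast)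
      then have "card ?D = k" using \<open>card D = k\<close> by (simp add: card_image)
      moreover have "?D \<subseteq> E" "finite ?D"
        using DT finite_subset[OF DT fin] by (auto simp: \<T>_def)
      moreover have "x \<in> \<Inter>?D" using D(1) by (auto simp: F_def)
      moreover have "pairwise (\<lambda>e f. edge_vertices V e \<inter> edge_vertices V f = {}) ?D"
      proof (rule pairwiseI)
        fix e f assume "e \<in> ?D" "f \<in> ?D" "e \<noteq> f"
        then obtain S T where "S \<in> D" "T \<in> D" "S \<noteq> T" "e = convex hull S" "f = convex hull T"
          by blast
        then show "edge_vertices V e \<inter> edge_vertices V f = {}"
          using DT hull_inj D(2) by (auto simp: pairwise_def disjnt_def subset_iff)
      qed
      ultimately show False
        using G(2) unfolding contains_strongly_crossing_def by blast
    qed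
  qed
  obtain t where t: "inj_on (\<lambda>p. p $ 1 + t * p $ 2) V"
    using exists_generic_projection[OF V(1)] .
  \<comment> \<open>The shear by \<open>t\<close> gives the vertices distinct abscissas, and
    \<open>X\<close>, \<open>Y\<close> still determine a point.\<close>
  define X Y :: "real ^ 2 \<Rightarrow> real" where "X p = p $ 1 + t * p $ 2" and "Y p = p $ 2" for p
  have X: "linear X" and Y: "linear Y"
    by (rule linearI; simp add: X_def Y_def algebra_simps)+
  have XY: "v = 0" if "X v = 0" "Y v = 0" for v
    using that by (simp add: X_def Y_def vec_eq_iff forall_2)
  have inj: "inj_on X V" using t by (simp add: X_def[abs_def])
  define H where "H = {(T, s). T \<in> \<T> \<and> pierced X V T s}"
  define supp :: "(real ^ 2) set \<times> (real ^ 2) \<times> (real ^ 2) \<times> (real ^ 2) \<Rightarrow> (real ^ 2) set"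
    where "supp = (\<lambda>(T, u, v, w). T \<union> {u, v, w})"
  \<comment> \<open>The incidences are grouped by candidate: at most n^3 triples \<open>s\<close>,
    each with at most 3 k n^2 triangles through its point.\<close>
  let ?S = "SIGMA s : V \<times> V \<times> V. F (case s of (u, v, w) \<Rightarrow> point_at X v w (X u))"
  have finF: "finite (F x)" for x using fin by (simp add: F_def)
  have HS: "H \<subseteq> (\<lambda>(s, T). (T, s)) ` ?S"
    by (force simp: H_def pierced_def F_def)
  have finS: "finite ?S" using V finF by auto
  have finH: "finite H" using HS finS finite_surj by blast
  have "card H \<le> card ?S" using HS finS surj_card_le by blast
  also have "\<dots> = (\<Sum>s \<in> V \<times> V \<times> V. card (F (case s of (u, v, w) \<Rightarrow> point_at X v w (X u))))"
    using V finF by (intro card_SigmaI) auto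
  also have "\<dots> \<le> card (V \<times> V \<times> V) * (3 * k * n\<^sup>2)"
    using sum_bounded_above[of "V \<times> V \<times> V" _ "3 * k * n\<^sup>2"] cF by simp
  also have "\<dots> = 3 * k * n ^ 5"
    by (simp add: card_cartesian_product n_def eval_nat_numeral)
  finally have cH: "card H \<le> 3 * k * n ^ 5" .
  have supp: "supp h \<subseteq> V \<and> card (supp h) = 6" if "h \<in> H" for h
  proof -
    obtain T u v w where h: "h = (T, u, v, w)" by (cases h)
    have T: "T \<subseteq> V" "card T = 3" "finite T"
      using that V finite_subset by (auto simp: h H_def \<T>_def)
    have uvw: "u \<in> V - T" "v \<in> V - T" "w \<in> V - T" "X v < X u" "X u < X w"
      using that by (auto simp: h H_def pierced_def)
    then have "u \<noteq> v" "v \<noteq> w" "u \<noteq> w" by auto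
    then have "card (T \<union> {u, v, w}) = 6"
      using T uvw by simp
    then show ?thesis
      using T uvw by (auto simp: h supp_def)
  qed
  \<comment> \<open>Within \<open>Z\<close>, a triangle is unpierced or is the first component of an
    incidence supported in \<open>Z\<close>.\<close>
  have sub: "card {T \<in> \<T>. T \<subseteq> Z} \<le> 12 * (card Z)\<^sup>2 + card {h \<in> H. supp h \<subseteq> Z}"
    if Z: "Z \<subseteq> V" for Z
  proof -
    let ?U = "{T. T \<subseteq> Z \<and> card T = 3 \<and> (\<forall>s. \<not> pierced X Z T s)}"
    have finZ: "finite Z" using Z V finite_subset by blast
    have gZ: "general_position Z" using Z V(2) by (auto simp: general_position_def)
    have iZ: "inj_on X Z" using Z inj inj_on_subset by blast
    have "{T \<in> \<T>. T \<subseteq> Z} \<subseteq> ?U \<union> fst ` {h \<in> H. supp h \<subseteq> Z}"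
    proof
      fix T assume T: "T \<in> {T \<in> \<T>. T \<subseteq> Z}"
      show "T \<in> ?U \<union> fst ` {h \<in> H. supp h \<subseteq> Z}"
      proof (cases "\<forall>s. \<not> pierced X Z T s")
        case True
        then show ?thesis using T by (simp add: \<T>_def)
      next
        case False
        then obtain u v w where s: "pierced X Z T (u, v, w)" by auto
        then have "(T, u, v, w) \<in> {h \<in> H. supp h \<subseteq> Z}"
          using T Z by (auto simp: H_def supp_def pierced_def)
        then show ?thesis by force
      qed
    qed
    moreover have "finite ?U"
      by (rule finite_subset[of _ "Pow Z"]) (use finZ in auto)
    ultimately have "card {T \<in> \<T>. T \<subseteq> Z} \<le> card (?U \<union> fst ` {h \<in> H. supp h \<subseteq> Z})"
      using finH by (intro card_mono) auto
    also have "\<dots> \<le> card ?U + card (fst ` {h \<in> H. supp h \<subseteq> Z})" by (rule card_Un_le)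
    also have "\<dots> \<le> 12 * (card Z)\<^sup>2 + card {h \<in> H. supp h \<subseteq> Z}"
      using finH by (intro add_mono card_unpierced_triangles_le[OF X Y XY finZ gZ iZ] card_image_le) auto
    finally show ?thesis .
  qed
  have "card \<T> \<le> card {T. T \<subseteq> V \<and> card T = 3}"
    by (rule card_mono) (use V in \<open>auto simp: \<T>_def\<close>)
  also have "\<dots> = n choose 3" using V by (simp add: n_subsets n_def)
  also have "\<dots> \<le> n ^ 3" by (cases "3 \<le> n") (simp_all add: binomial_le_pow binomial_eq_0)
  finally have cT: "card \<T> \<le> n ^ 3" .
  have "real (card \<T>) * real q ^ 3 \<le> 24 * (real n)\<^sup>2 * real q ^ 4 + 3 * real k * real n ^ 5"
    if "1 \<le> q" "q \<le> n" for q
  proof -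
    have "real (card \<T>) * real q ^ 3 \<le>
        2 * real 12 * (real (card V))\<^sup>2 * real q ^ 4 + real (card H)"
      by (rule sampling_amplification[OF V(1) fin _ finH supp sub])
        (use that in \<open>auto simp: \<T>_def n_def\<close>)
    moreover have "real (card H) \<le> 3 * real k * real n ^ 5"
      using of_nat_mono[OF cH, where 'a = real] by simp
    ultimately show ?thesis by (simp add: n_def)
  qed
  then have "real (card \<T>) \<le> (96 + 4 * real k * 192 ^ 3) * real n powr (11 / 4)"
    using bound_of_sampling[OF _ cT] V1 by (simp add: n_def)
  then show ?thesis
    using EcT by (simp add: n_def)
qed

theorem theorem1p3:
  fixes k :: nat
  assumes "k \<ge> 4"
  shows "\<exists>C :: real. \<forall>n :: nat. n \<ge> 1 \<longrightarrow>
           real (ex2_SC k n) \<le> C * real n powr (3 - 1 / real k)"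
proof (intro exI allI impI)
  fix n :: nat assume n: "n \<ge> 1"
  have "ex2_SC k n \<in> SC_free_sizes k n"
    unfolding ex2_SC_def using assms
    by (intro Max_in finite_SC_free_sizes SC_free_sizes_nonempty) auto
  then obtain V E where "ex2_SC k n = card E" "geometric_3_hypergraph V E" "card V = n"
    "\<not> contains_strongly_crossing k V E"
    unfolding SC_free_sizes_def by blast
  then have "real (ex2_SC k n) \<le> (96 + 4 * real k * 192 ^ 3) * real n powr (11 / 4)"
    using card_edges_le[of V E k] n by simp
  \<comment> \<open>Here 11/4 = 3 - 1/4 is at most 3 - 1/k as k is at least 4, and the base n is at
    least 1.\<close>
  also have "\<dots> \<le> (96 + 4 * real k * 192 ^ 3) * real n powr (3 - 1 / real k)"
    using assms n by (intro mult_left_mono powr_mono) (auto simp: field_simps)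
  finally show "real (ex2_SC k n) \<le> (96 + 4 * real k * 192 ^ 3) * real n powr (3 - 1 / real k)" .
qed

end
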